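(* For all integers $m \geq 1$ and $n \geq 0$, the number of spanning trees of the generalized cone $C^mK_n$ of the complete graph $K_n$ is $$t(C^m K_n)=m\,(m+n)^{n-1}.$$
   Context: Graphs are finite and connected, and may have multiple edges and self-loops; $t(G)$ denotes the number of spanning trees of $G$, where parallel edges are distinguished (so two spanning trees using different parallel edges count as different). $K_n$ is the complete graph on $n$ vertices ($K_0$ is the empty graph). For a graph $G$ and an integer $m\geq 1$, the generalized cone $C^mG$ is obtained from $G$ by adding one new vertex $p$ and joining $p$ to each vertex of $G$ by exactly $m$ parallel edges. In particular $C^mK_0$ is a single vertex, and $t$ of it is $1$. *)

theory Defs
  imports Complex_Main
begin

text \<open>
  Undirected multigraphs: edges carry their own identity, so parallel edges are distinct edges with
  the same set of end vertices, and a self-loop at \<open>v\<close> is an edge whose set of ends is \<open>{v}\<close>.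
\<close>

record ('v, 'e) mgraph =
  verts :: "'v set"
  edges :: "'e set"
  ends :: "'e \<Rightarrow> 'v set"

locale multigraph =
  fixes G :: "('v, 'e) mgraph" (structure)
  assumes finite_verts: "finite (verts G)"
    and finite_edges: "finite (edges G)"
    and ends_wf: "e \<in> edges G \<Longrightarrow> \<exists>u\<in>verts G. \<exists>v\<in>verts G. ends G e = {u, v}"

definition adj :: "('v, 'e) mgraph \<Rightarrow> ('v \<times> 'v) set" where
  "adj G = {(u, v). \<exists>e\<in>edges G. ends G e = {u, v}}"

definition connected_graph :: "('v, 'e) mgraph \<Rightarrow> bool" where
  "connected_graph G \<longleftrightarrow> (\<forall>u\<in>verts G. \<forall>v\<in>verts G. (u, v) \<in> (adj G)\<^sup>*)"

text \<open>
  The cycle \<open>vs ! 0, es ! 0, vs ! 1, es ! 1, \<dots>, vs ! 0\<close>; length 1 is a self-loop, and length 2 is a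
  pair of distinct parallel edges.
\<close>

definition is_cycle :: "('v, 'e) mgraph \<Rightarrow> 'v list \<Rightarrow> 'e list \<Rightarrow> bool" where
  "is_cycle G vs es \<longleftrightarrow>
     es \<noteq> [] \<and> length vs = length es \<and> distinct vs \<and> distinct es \<and>
     set vs \<subseteq> verts G \<and> set es \<subseteq> edges G \<and>
     (\<forall>i<length es. ends G (es ! i) = {vs ! i, vs ! (Suc i mod length es)})"

definition is_tree :: "('v, 'e) mgraph \<Rightarrow> bool" where
  "is_tree G \<longleftrightarrow> connected_graph G \<and> (\<nexists>vs es. is_cycle G vs es)"

text \<open>A spanning subgraph keeps all vertices, so it is determined by its edge set.\<close>

definition spanning_trees :: "('v, 'e) mgraph \<Rightarrow> 'e set set" where
  "spanning_trees G = {T. T \<subseteq> edges G \<and> is_tree (G\<lparr>edges := T\<rparr>)}"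

definition num_spanning_trees :: "('v, 'e) mgraph \<Rightarrow> nat" where
  "num_spanning_trees G = card (spanning_trees G)"

definition complete_graph :: "nat \<Rightarrow> (nat, nat set) mgraph" where
  "complete_graph n =
     \<lparr>verts = {..<n}, edges = {e. e \<subseteq> {..<n} \<and> card e = 2}, ends = (\<lambda>e. e)\<rparr>"

text \<open>
  The new vertex of the cone is \<open>None\<close>; the edges \<open>Inr (v, i)\<close> with \<open>i < m\<close> are the \<open>m\<close> parallel
  edges joining it to \<open>v\<close>.
\<close>

definition cone :: "nat \<Rightarrow> ('v, 'e) mgraph \<Rightarrow> ('v option, 'e + 'v \<times> nat) mgraph" where
  "cone m G =
     \<lparr>verts = insert None (Some ` verts G),
      edges = Inl ` edges G \<union> Inr ` (verts G \<times> {..<m}),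
      ends = case_sum (\<lambda>e. Some ` ends G e) (\<lambda>(v, i). {None, Some v})\<rparr>"

lemma multigraph_complete_graph: "multigraph (complete_graph n)"
proof
  fix e assume "e \<in> edges (complete_graph n)"
  then show "\<exists>u\<in>verts (complete_graph n). \<exists>v\<in>verts (complete_graph n).
      ends (complete_graph n) e = {u, v}"
    by (auto simp: complete_graph_def card_2_iff)
qed (auto simp: complete_graph_def)

lemma multigraph_cone:
  assumes "multigraph G"
  shows "multigraph (cone m G)"
proof -
  interpret multigraph G by fact
  show ?thesis
  proof
    fix e assume "e \<in> edges (cone m G)"
    then show "\<exists>u\<in>verts (cone m G). \<exists>v\<in>verts (cone m G). ends (cone m G) e = {u, v}"
      by (fastforce simp: cone_def dest: ends_wf)
  qed (auto simp: cone_def finite_verts finite_edges)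
qed

lemma connected_graph_cone:
  assumes "m \<ge> 1"
  shows "connected_graph (cone m G)"
proof -
  have *: "(None, Some v) \<in> adj (cone m G)" "(Some v, None) \<in> adj (cone m G)"
    if "v \<in> verts G" for v
    using that assms unfolding adj_def cone_def
    by (auto intro!: bexI[of _ "Inr (v, 0)"])
  have "(u, None) \<in> (adj (cone m G))\<^sup>* \<and> (None, u) \<in> (adj (cone m G))\<^sup>*"
    if "u \<in> verts (cone m G)" for u
    using that * by (auto simp: cone_def)
  then show ?thesis
    unfolding connected_graph_def by (meson rtrancl_trans)
qed

end

theory Submission
  imports Defs "HOL-Library.FuncSet"
begin

text \<open>
  Orienting every edge of a spanning tree towards a root turns the tree into the function sending
  each other vertex to its parent edge. For the cone, with its apex as the root, these are the functions
  \<open>f\<close> from the \<open>n\<close> vertices \<open>V\<close> to \<open>V \<union> R\<close>, where \<open>R\<close> is a set of \<open>m\<close> labels for the parallel edges,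
  such that iterating \<open>f\<close> leads every vertex to \<open>R\<close>. If \<open>S\<close> is the set of vertices mapped into \<open>R\<close>,
  then the rest of \<open>f\<close> is a function of the same kind for \<open>V - S\<close> and \<open>S\<close>, so the number \<open>a n m\<close> of
  them satisfies \<open>a n m = (\<Sum>k\<le>n. (n choose k) * m ^ k * a (n - k) k)\<close>, and the binomial theorem
  gives \<open>a n m = m * (m + n) ^ (n - 1)\<close> by induction.
\<close>

section \<open>Functions leading into a set of roots\<close>

text \<open>The potential \<open>d\<close> encodes that every orbit starting in \<open>V\<close>
  leaves \<open>V\<close>: a descent in the naturals must stop, and conversely the number of steps
  until then is a potential.\<close>

definition rooted_maps :: "'a set \<Rightarrow> 'a set \<Rightarrow> ('a \<Rightarrow> 'a) set" where
  "rooted_maps V R =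
     {f \<in> V \<rightarrow>\<^sub>E V \<union> R. \<exists>d :: 'a \<Rightarrow> nat. \<forall>v\<in>V. d (f v) < d v}"

lemma finite_rooted_maps:
  assumes "finite V" "finite R"
  shows "finite (rooted_maps V R)"
  by (rule finite_subset[of _ "V \<rightarrow>\<^sub>E V \<union> R"])
    (use assms in \<open>auto simp: rooted_maps_def intro!: finite_PiE\<close>)

text \<open>Restricting \<open>f\<close> to \<open>S\<close> and to \<open>V - S\<close> is a
  bijection: the values on \<open>S\<close> are free in \<open>R\<close>, while on
  \<open>V - S\<close> the set \<open>S\<close> takes over the role of the roots.\<close>

lemma card_rooted_maps_fiber:
  assumes "finite V" "finite R" "V \<inter> R = {}" "S \<subseteq> V"
  shows "card {f \<in> rooted_maps V R. {v \<in> V. f v \<in> R} = S} =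
    card R ^ card S * card (rooted_maps (V - S) S)"
proof -
  let ?F = "{f \<in> rooted_maps V R. {v \<in> V. f v \<in> R} = S}"
  let ?P = "(S \<rightarrow>\<^sub>E R) \<times> rooted_maps (V - S) S"
  let ?split = "\<lambda>f. (restrict f S, restrict f (V - S))"
  let ?join = "\<lambda>(g, h). \<lambda>v\<in>V. if v \<in> S then g v else h v"
  have "bij_betw ?split ?F ?P"
  proof (rule bij_betw_byWitness[of _ ?join])
    show "\<forall>f\<in>?F. ?join (?split f) = f"
      by (auto simp: rooted_maps_def fun_eq_iff PiE_def extensional_def)
    show "\<forall>gh\<in>?P. ?split (?join gh) = gh"
      using assms(4)
      by (auto simp: rooted_maps_def fun_eq_iff PiE_def extensional_def)
    show "?split ` ?F \<subseteq> ?P"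
    proof
      fix gh assume "gh \<in> ?split ` ?F"
      then obtain f where f: "f \<in> rooted_maps V R" "{v \<in> V. f v \<in> R} = S" "gh = ?split f"
        by auto
      have "f \<in> V - S \<rightarrow> (V - S) \<union> S"
        using f by (auto simp: rooted_maps_def PiE_def Pi_def)
      moreover obtain d :: "'a \<Rightarrow> nat" where "\<forall>v\<in>V. d (f v) < d v"
        using f(1) by (auto simp: rooted_maps_def)
      ultimately have "restrict f (V - S) \<in> rooted_maps (V - S) S"
        by (auto simp: rooted_maps_def intro!: exI[of _ d])
      then show "gh \<in> ?P"
        using f by auto
    qed
    show "?join ` ?P \<subseteq> ?F"
    proof
      fix f assume "f \<in> ?join ` ?P"
      then obtain g h where gh: "g \<in> S \<rightarrow>\<^sub>E R" "h \<in> rooted_maps (V - S) S" "f = ?join (g, h)"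
        by auto
      obtain d :: "'a \<Rightarrow> nat" where d: "\<forall>v\<in>V - S. d (h v) < d v"
        using gh(2) by (auto simp: rooted_maps_def)
      have h: "h v \<in> V" if "v \<in> V - S" for v
        using gh(2) that assms(4) by (auto simp: rooted_maps_def PiE_def Pi_def)
      have fS: "f v = g v" "g v \<in> R" "g v \<notin> V" if "v \<in> S" for v
        using that gh assms(3,4) by (auto simp: PiE_def Pi_def)
      have fV: "f v = h v" "h v \<notin> R" if "v \<in> V - S" for v
        using that gh(3) h[OF that] assms(3) by auto
      \<comment> \<open>Nothing is known about \<open>d\<close> on \<open>R\<close>, so it is reset
        to 0 there; raising it by one on \<open>V\<close> makes each move from \<open>S\<close> into
        \<open>R\<close> a descent.\<close>
      let ?d = "\<lambda>v. if v \<in> V then Suc (d v) else 0"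
      have "\<forall>v\<in>V. ?d (f v) < ?d v"
      proof
        fix v assume "v \<in> V"
        then show "?d (f v) < ?d v"
          using fS[of v] fV[of v] d h[of v] by (cases "v \<in> S") auto
      qed
      moreover have "f \<in> V \<rightarrow>\<^sub>E V \<union> R"
        using gh(3) fS fV h by auto
      ultimately have "f \<in> rooted_maps V R"
        unfolding rooted_maps_def by (intro CollectI conjI exI[of _ ?d])
      moreover have "f v \<in> R \<longleftrightarrow> v \<in> S" if "v \<in> V" for v
        using fS[of v] fV[of v] that by (cases "v \<in> S") auto
      then have "{v \<in> V. f v \<in> R} = S"
        using assms(4) by blast
      ultimately show "f \<in> ?F"
        by blast
    qed
  qed
  then have "card ?F = card ?P"
    by (rule bij_betw_same_card)
  also have "\<dots> = card R ^ card S * card (rooted_maps (V - S) S)"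
    using assms by (simp add: card_cartesian_product card_funcsetE finite_subset[of S V])
  finally show ?thesis .
qed

lemma card_rooted_maps_recursion:
  assumes "finite V" "finite R" "V \<inter> R = {}"
  shows "card (rooted_maps V R) =
    (\<Sum>S\<in>Pow V. card R ^ card S * card (rooted_maps (V - S) S))"
proof -
  let ?s = "\<lambda>f. {v \<in> V. f v \<in> R}"
  have "card (rooted_maps V R) = (\<Sum>f\<in>rooted_maps V R. 1)"
    by simp
  also have "\<dots> = (\<Sum>S\<in>Pow V. \<Sum>f\<in>{f \<in> rooted_maps V R. ?s f = S}. 1)"
    by (rule sum.group[symmetric]) (use assms in \<open>auto simp: finite_rooted_maps\<close>)
  also have "\<dots> = (\<Sum>S\<in>Pow V. card R ^ card S * card (rooted_maps (V - S) S))"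
    using card_rooted_maps_fiber[OF assms] by (intro sum.cong) auto
  finally show ?thesis .
qed

section \<open>Binomial sums and the closed form\<close>

lemma sum_Pow_card:
  fixes g :: "nat \<Rightarrow> 'b::semiring_1"
  assumes "finite A"
  shows "(\<Sum>S\<in>Pow A. g (card S)) = (\<Sum>k\<le>card A. of_nat (card A choose k) * g k)"
proof -
  have "(\<Sum>S\<in>Pow A. g (card S)) = (\<Sum>k\<le>card A. \<Sum>S\<in>{S \<in> Pow A. card S = k}. g (card S))"
    by (rule sum.group[symmetric]) (use assms in \<open>auto simp: card_mono\<close>)
  also have "\<dots> = (\<Sum>k\<le>card A. of_nat (card A choose k) * g k)"
    using n_subsets[OF assms] by (intro sum.cong) auto
  finally show ?thesis .
qed

text \<open>Absorption, \<open>k * (Suc n choose k) = Suc n * (n choose (k - 1))\<close> for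
  positive \<open>k\<close>, removes the factor \<open>k\<close>, and the binomial theorem for
  exponent \<open>n\<close> remains.\<close>

lemma sum_binomial_weighted:
  fixes x y :: "'a::comm_semiring_1"
  shows "(\<Sum>k\<le>Suc n. of_nat (Suc n choose k) * (x ^ k * (of_nat k * y ^ (Suc n - k)))) =
    of_nat (Suc n) * x * (x + y) ^ n"
proof -
  have "(\<Sum>k\<le>Suc n. of_nat (Suc n choose k) * (x ^ k * (of_nat k * y ^ (Suc n - k)))) =
      (\<Sum>k\<le>n. of_nat (Suc k * (Suc n choose Suc k)) * (x ^ Suc k * y ^ (n - k)))"
    by (subst sum.atMost_Suc_shift) (simp add: mult_ac del: binomial_Suc_Suc of_nat_Suc mult_Suc)
  also have "\<dots> = (\<Sum>k\<le>n. of_nat (Suc n) * x * (of_nat (n choose k) * x ^ k * y ^ (n - k)))"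
    unfolding binomial_absorption[of _ "Suc n"] by (simp add: mult_ac del: of_nat_Suc mult_Suc)
  also have "\<dots> = of_nat (Suc n) * x * (x + y) ^ n"
    by (simp only: binomial_ring sum_distrib_left)
  finally show ?thesis .
qed

text \<open>Multiplying by \<open>card V + card R\<close> avoids the truncated exponent
  \<open>card V - 1\<close>. In the recursion \<open>V - S\<close> and \<open>S\<close> together
  always have \<open>card V\<close> elements, so the summands share one base and form a binomial
  sum.\<close>

lemma card_rooted_maps:
  assumes "finite V" "finite R" "V \<inter> R = {}"
  shows "(card V + card R) * card (rooted_maps V R) = card R * (card V + card R) ^ card V"
  using assms
proof (induction "card V" arbitrary: V R rule: less_induct)
  case less
  show ?case
  proof (cases "V = {}")
    case True
    then show ?thesis
      by (simp add: rooted_maps_def)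
  next
    case False
    then obtain n where n: "card V = Suc n"
      using less.prems(1) by (metis card_0_eq not0_implies_Suc)
    have IH: "Suc n * card (rooted_maps (V - S) S) = card S * Suc n ^ (Suc n - card S)"
      if "S \<in> Pow V" for S
    proof (cases "S = {}")
      case True
      \<comment> \<open>Here \<open>V - S\<close> is \<open>V\<close> itself, out of reach of the
        induction. But no map leads the nonempty \<open>V\<close> into an empty root set: a vertex
        of least potential cannot descend.\<close>
      have "rooted_maps V {} = {}"
      proof -
        have False if f: "f \<in> V \<rightarrow>\<^sub>E V" "\<forall>v\<in>V. d (f v) < d v" for f and d :: "'a \<Rightarrow> nat"
        proof -
          obtain v where "v \<in> V" "\<And>w. w \<in> V \<Longrightarrow> d v \<le> d w"
            using False ex_has_least_nat[of "\<lambda>v. v \<in> V" _ d] by blast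
          then show False
            using f by (meson PiE_mem leD)
        qed
        then show ?thesis
          unfolding rooted_maps_def Un_empty_right by blast
      qed
      then show ?thesis
        using True by simp
    next
      case False
      have fin: "finite S"
        using that less.prems(1) by (auto intro: finite_subset)
      then have "card (V - S) < card V"
        using False that less.prems(1) by (intro psubset_card_mono) auto
      moreover have "card (V - S) = Suc n - card S" "card S \<le> Suc n"
        using that n fin less.prems(1) by (auto simp: card_Diff_subset card_mono simp flip: n)
      ultimately show ?thesis
        using less.hyps[of "V - S" S] fin less.prems(1) by (simp add: Diff_disjoint Int_commute)
    qed
    \<comment> \<open>The factor \<open>Suc n\<close> brings the summands into the form of
      \<open>IH\<close>; the binomial sum yields the same factor, and it cancels.\<close>
    have "Suc n * card (rooted_maps V R) =
        (\<Sum>S\<in>Pow V. card R ^ card S * (Suc n * card (rooted_maps (V - S) S)))"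
      by (simp only: card_rooted_maps_recursion[OF less.prems] sum_distrib_left mult.left_commute)
    also have "\<dots> = (\<Sum>S\<in>Pow V. card R ^ card S * (card S * Suc n ^ (Suc n - card S)))"
      by (intro sum.cong) (simp_all only: IH)
    also have "\<dots> = Suc n * (card R * (card R + Suc n) ^ n)"
      using sum_Pow_card[OF less.prems(1), of "\<lambda>k. card R ^ k * (k * Suc n ^ (Suc n - k))"]
        sum_binomial_weighted[of n "card R" "Suc n"]
      by (simp only: n of_nat_id mult.assoc)
    finally have "card (rooted_maps V R) = card R * (card R + Suc n) ^ n"
      by (simp only: mult_cancel1 nat.distinct simp_thms)
    then show ?thesis
      by (simp add: n add.commute mult_ac)
  qed
qed

section \<open>Spanning trees as parent edge functions\<close>

lemma multigraph_edges_subset: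
  assumes "multigraph G" "T \<subseteq> edges G"
  shows "multigraph (G\<lparr>edges := T\<rparr>)"
  using assms unfolding multigraph_def by (auto intro: finite_subset)

lemma adj_mono: "S \<subseteq> T \<Longrightarrow> adj (G\<lparr>edges := S\<rparr>) \<subseteq> adj (G\<lparr>edges := T\<rparr>)"
  by (auto simp: adj_def)

lemma sym_adj: "sym (adj G)"
  by (auto simp: adj_def sym_def insert_commute)

lemma adj_verts:
  assumes "multigraph G" "(u, v) \<in> adj G"
  shows "u \<in> verts G" "v \<in> verts G"
  using assms multigraph.ends_wf[OF assms(1)] by (fastforce simp: adj_def doubleton_eq_iff)+

text \<open>The path is kept simple as the walk grows: a new vertex extends it, a repeated one cuts
  it back to the earlier occurrence. Distinct vertices then force distinct edges.\<close>

lemma rtrancl_adj_simple_path: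
  assumes "multigraph G" "u \<in> verts G" "(u, v) \<in> (adj G)\<^sup>*"
  obtains vs es where "length vs = Suc (length es)" "distinct vs" "distinct es"
    "set vs \<subseteq> verts G" "set es \<subseteq> edges G"
    "\<And>i. i < length es \<Longrightarrow> ends G (es ! i) = {vs ! i, vs ! Suc i}"
    "vs ! 0 = u" "vs ! length es = v"
proof -
  have "\<exists>vs es. length vs = Suc (length es) \<and> distinct vs \<and> set vs \<subseteq> verts G \<and>
      set es \<subseteq> edges G \<and> (\<forall>i<length es. ends G (es ! i) = {vs ! i, vs ! Suc i}) \<and>
      vs ! 0 = u \<and> vs ! length es = v"
    using assms(3)
  proof (induction rule: rtrancl_induct)
    case base
    show ?case
      using assms(2) by (intro exI[of _ "[u]"] exI[of _ "[]"]) simp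
  next
    case (step y z)
    then obtain vs es where *: "length vs = Suc (length es)" "distinct vs" "set vs \<subseteq> verts G"
        "set es \<subseteq> edges G" "\<forall>i<length es. ends G (es ! i) = {vs ! i, vs ! Suc i}"
        "vs ! 0 = u" "vs ! length es = y"
      by blast
    show ?case
    proof (cases "z \<in> set vs")
      case True
      then obtain k where k: "k < length vs" "vs ! k = z"
        by (auto simp: in_set_conv_nth)
      have "set (take (Suc k) vs) \<subseteq> verts G" "set (take k es) \<subseteq> edges G"
        using * set_take_subset by fastforce+
      then show ?thesis
        using k * by (intro exI[of _ "take (Suc k) vs"] exI[of _ "take k es"]) (auto simp: min_def le_less_Suc_eq)
    next
      case False
      obtain e where "e \<in> edges G" "ends G e = {y, z}"
        using step.hyps(2) by (auto simp: adj_def)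
      then show ?thesis
        using False * adj_verts[OF assms(1) step.hyps(2)]
        by (intro exI[of _ "vs @ [z]"] exI[of _ "es @ [e]"]) (auto simp: nth_append less_Suc_eq)
    qed
  qed
  then obtain vs es where *: "length vs = Suc (length es)" "distinct vs" "set vs \<subseteq> verts G"
      "set es \<subseteq> edges G" "\<forall>i<length es. ends G (es ! i) = {vs ! i, vs ! Suc i}"
      "vs ! 0 = u" "vs ! length es = v"
    by blast
  have "distinct es"
    unfolding distinct_conv_nth
  proof (intro allI impI)
    fix i j assume ij: "i < length es" "j < length es" "i \<noteq> j"
    show "es ! i \<noteq> es ! j"
    proof
      assume "es ! i = es ! j"
      then have "{vs ! i, vs ! Suc i} = {vs ! j, vs ! Suc j}"
        using *(5) ij by metis
      \<comment> \<open>A crosswise match of the ends would need both \<open>i = Suc j\<close> and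
        \<open>j = Suc i\<close>.\<close>
      then show False
        using ij *(1,2) by (auto simp: doubleton_eq_iff nth_eq_iff_index_eq)
    qed
  qed
  with * that show ?thesis
    by blast
qed

text \<open>A simple path that avoids \<open>e\<close> is closed by \<open>e\<close>. For
  \<open>u = v\<close> the path has no edges and the cycle is the loop \<open>e\<close>.\<close>

lemma cycle_if_ends_connected:
  assumes "multigraph G" "e \<in> edges G" "ends G e = {u, v}"
    and "(u, v) \<in> (adj (G\<lparr>edges := edges G - {e}\<rparr>))\<^sup>*"
  shows "\<exists>vs es. is_cycle G vs es"
proof -
  have "u \<in> verts G"
    using adj_verts(1)[OF assms(1), of u v] assms(2,3) by (auto simp: adj_def)
  then obtain vs es where p: "length vs = Suc (length es)" "distinct vs" "distinct es"
      "set vs \<subseteq> verts G" "set es \<subseteq> edges G - {e}"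
      "\<And>i. i < length es \<Longrightarrow> ends G (es ! i) = {vs ! i, vs ! Suc i}"
      "vs ! 0 = u" "vs ! length es = v"
    using rtrancl_adj_simple_path[OF multigraph_edges_subset[OF assms(1)] _ assms(4)] by auto
  have "is_cycle G vs (es @ [e])"
    unfolding is_cycle_def
  proof (intro conjI allI impI)
    fix i assume "i < length (es @ [e])"
    then consider "i < length es" | "i = length es"
      by force
    then show "ends G ((es @ [e]) ! i) = {vs ! i, vs ! (Suc i mod length (es @ [e]))}"
      using p(6-8) assms(3) by cases (simp_all add: nth_append insert_commute)
  qed (use p assms(2) in auto)
  then show ?thesis
    by blast
qed

section \<open>Parent edge functions and their trees\<close>

text \<open>The values are edges rather than parent vertices, since parallel edges give different
  trees. The potential \<open>d\<close> excludes self-loops and chains of parents that run in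
  circles.\<close>

definition parent_edge_maps :: "('v, 'e) mgraph \<Rightarrow> 'v \<Rightarrow> ('v \<Rightarrow> 'e) set" where
  "parent_edge_maps G r =
     {p \<in> verts G - {r} \<rightarrow>\<^sub>E edges G. \<exists>d :: 'v \<Rightarrow> nat.
        \<forall>v\<in>verts G - {r}. \<exists>u. ends G (p v) = {v, u} \<and> d u < d v}"

lemma parent_edge_mapsE:
  assumes "p \<in> parent_edge_maps G r"
  obtains d :: "'v \<Rightarrow> nat"
  where "\<And>v. v \<in> verts G \<Longrightarrow> v \<noteq> r \<Longrightarrow> \<exists>u. ends G (p v) = {v, u} \<and> d u < d v"
  using assms unfolding parent_edge_maps_def by blast

text \<open>Parent edges lower \<open>d\<close>, so following them from any vertex ends at
  \<open>r\<close>, the only vertex without one; symmetry of \<open>adj\<close> gives the way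
  back.\<close>

lemma connected_graph_parent_edges:
  assumes "multigraph G" "p \<in> parent_edge_maps G r"
  shows "connected_graph (G\<lparr>edges := p ` (verts G - {r})\<rparr>)"
proof -
  let ?H = "G\<lparr>edges := p ` (verts G - {r})\<rparr>"
  have p: "p ` (verts G - {r}) \<subseteq> edges G"
    using assms(2) by (auto simp: parent_edge_maps_def)
  obtain d :: "'a \<Rightarrow> nat" where
    d: "\<And>v. v \<in> verts G \<Longrightarrow> v \<noteq> r \<Longrightarrow> \<exists>u. ends G (p v) = {v, u} \<and> d u < d v"
    using parent_edge_mapsE[OF assms(2)] by blast
  have to_root: "(v, r) \<in> (adj ?H)\<^sup>*" if "v \<in> verts G" for v
    using that
  proof (induction "d v" arbitrary: v rule: less_induct)
    case less
    show ?case
    proof (cases "v = r")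
      case False
      then obtain u where u: "ends G (p v) = {v, u}" "d u < d v"
        using d less.prems by blast
      then have "(v, u) \<in> adj ?H"
        using False less.prems by (auto simp: adj_def)
      moreover from this have "u \<in> verts G"
        using adj_verts(2)[OF multigraph_edges_subset[OF assms(1) p], of v u] by simp
      ultimately show ?thesis
        using less.hyps[of u] u(2) by (meson converse_rtrancl_into_rtrancl)
    qed simp
  qed
  moreover have "sym ((adj ?H)\<^sup>*)"
    by (simp add: sym_rtrancl sym_adj)
  ultimately show ?thesis
    unfolding connected_graph_def by (simp, metis rtrancl_trans symD)
qed

text \<open>
  Both cycle edges at a cycle vertex of maximal depth would have to be the parent edge of that vertex.
\<close>

lemma acyclic_parent_edges:
  assumes "p \<in> parent_edge_maps G r"
  shows "\<not> is_cycle (G\<lparr>edges := p ` (verts G - {r})\<rparr>) vs es"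
proof
  assume "is_cycle (G\<lparr>edges := p ` (verts G - {r})\<rparr>) vs es"
  then have c: "es \<noteq> []" "distinct es" "set es \<subseteq> p ` (verts G - {r})"
      "\<And>i. i < length es \<Longrightarrow> ends G (es ! i) = {vs ! i, vs ! (Suc i mod length es)}"
    by (auto simp: is_cycle_def)
  obtain d :: "'a \<Rightarrow> nat" where
    d: "\<And>v. v \<in> verts G \<Longrightarrow> v \<noteq> r \<Longrightarrow> \<exists>u. ends G (p v) = {v, u} \<and> d u < d v"
    using parent_edge_mapsE[OF assms] by blast
  \<comment> \<open>A parent edge belongs to its deeper end, and its strict descent excludes a
    loop.\<close>
  have par: "e = p x \<and> x \<noteq> y" if e: "e \<in> set es" "ends G e = {x, y}" "d y \<le> d x" for e x y
  proof -
    obtain v where v: "v \<in> verts G" "v \<noteq> r" "e = p v"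
      using e c(3) by auto
    then obtain u where "ends G e = {v, u}" "d u < d v"
      using d by blast
    then show ?thesis
      using e(2,3) v by (auto simp: doubleton_eq_iff)
  qed
  let ?L = "length es"
  obtain i where i: "i < ?L" "\<And>j. j < ?L \<Longrightarrow> d (vs ! j) \<le> d (vs ! i)"
  proof -
    have "Max ((\<lambda>j. d (vs ! j)) ` {..<?L}) \<in> (\<lambda>j. d (vs ! j)) ` {..<?L}"
      using c(1) by (intro Max_in) auto
    then obtain i where "i < ?L" "Max ((\<lambda>j. d (vs ! j)) ` {..<?L}) = d (vs ! i)"
      by auto
    moreover from this have "d (vs ! j) \<le> d (vs ! i)" if "j < ?L" for j
      using that by (metis Max_ge finite_imageI finite_lessThan imageI lessThan_iff)
    ultimately show ?thesis
      using that by blast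
  qed
  \<comment> \<open>The cyclic predecessor of \<open>i\<close>: \<open>es ! j\<close> is the cycle
    edge that arrives at \<open>vs ! i\<close>, while \<open>es ! i\<close> leaves it.\<close>
  define j where "j = (if i = 0 then ?L - 1 else i - 1)"
  have j: "j < ?L" "Suc j mod ?L = i"
    using i(1) by (auto simp: j_def)
  have out: "es ! i = p (vs ! i) \<and> vs ! i \<noteq> vs ! (Suc i mod ?L)"
    using i c(1) c(4)[OF i(1)] by (intro par i(2)) auto
  have "es ! j = p (vs ! i) \<and> vs ! i \<noteq> vs ! j"
    using i j c(4)[OF j(1)] by (intro par) auto
  with out have "i = j"
    using c(2) i(1) j(1) by (metis nth_eq_iff_index_eq)
  \<comment> \<open>If the two edges coincide, the cycle has length one and is a loop, which
    \<open>out\<close> excludes.\<close>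
  with j(2) out show False
    by simp
qed

lemma parent_edges_spanning_tree:
  assumes "multigraph G" "p \<in> parent_edge_maps G r"
  shows "p ` (verts G - {r}) \<in> spanning_trees G"
  using assms connected_graph_parent_edges[OF assms] acyclic_parent_edges[OF assms(2)]
  by (auto simp: spanning_trees_def is_tree_def parent_edge_maps_def)

text \<open>Induction on the potential of \<open>p\<close>. If \<open>p v \<noteq> q v\<close>, then
  \<open>p v = q w\<close> where \<open>w\<close> is the other end of that edge and lies below
  \<open>v\<close>. By induction \<open>p w = q w = p v\<close>, so the same edge also descends from
  \<open>w\<close> to \<open>v\<close>, a contradiction.\<close>

lemma inj_on_parent_edges:
  "inj_on (\<lambda>p. p ` (verts G - {r})) (parent_edge_maps G r)"
proof (rule inj_onI)
  fix p q
  assume pq: "p \<in> parent_edge_maps G r" "q \<in> parent_edge_maps G r"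
    and eq: "p ` (verts G - {r}) = q ` (verts G - {r})"
  obtain d :: "'a \<Rightarrow> nat" where
    d: "\<And>v. v \<in> verts G \<Longrightarrow> v \<noteq> r \<Longrightarrow> \<exists>u. ends G (p v) = {v, u} \<and> d u < d v"
    using parent_edge_mapsE[OF pq(1)] by blast
  obtain d' :: "'a \<Rightarrow> nat" where
    d': "\<And>v. v \<in> verts G \<Longrightarrow> v \<noteq> r \<Longrightarrow> \<exists>u. ends G (q v) = {v, u} \<and> d' u < d' v"
    using parent_edge_mapsE[OF pq(2)] by blast
  have "p v = q v" if "v \<in> verts G - {r}" for v
    using that
  proof (induction "d v" arbitrary: v rule: less_induct)
    case less
    obtain u where u: "ends G (p v) = {v, u}" "d u < d v"
      using d less.prems by blast
    obtain w where w: "w \<in> verts G - {r}" "p v = q w"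
      using eq less.prems by blast
    obtain x where x: "ends G (q w) = {w, x}"
      using d' w by blast
    show ?case
    proof (rule ccontr)
      assume "p v \<noteq> q v"
      then have "w = u"
        using u x w by (auto simp: doubleton_eq_iff)
      then have "p u = p v"
        using less.hyps[of u] u w by simp
      then obtain y where "{v, u} = {u, y}" "d y < d u"
        using d[of u] w \<open>w = u\<close> u(1) by auto
      then show False
        using u(2) by (auto simp: doubleton_eq_iff)
    qed
  qed
  then show "p = q"
    using pq by (auto simp: parent_edge_maps_def intro: PiE_ext)
qed

text \<open>The parent edge of \<open>v\<close> is the first edge of a shortest path in
  \<open>T\<close> from \<open>v\<close> to \<open>r\<close>, and the distance to \<open>r\<close>
  is the potential.\<close>

lemma spanning_tree_has_parent_edges:
  assumes "multigraph G" "r \<in> verts G" "T \<in> spanning_trees G"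
  obtains p where "p \<in> parent_edge_maps G r" "T = p ` (verts G - {r})"
proof -
  let ?A = "adj (G\<lparr>edges := T\<rparr>)"
  have T: "T \<subseteq> edges G" "connected_graph (G\<lparr>edges := T\<rparr>)"
      "\<nexists>vs es. is_cycle (G\<lparr>edges := T\<rparr>) vs es"
    using assms(3) by (auto simp: spanning_trees_def is_tree_def)
  define d where "d v = (LEAST k. (v, r) \<in> ?A ^^ k)" for v
  have "\<exists>e\<in>T. \<exists>u. ends G e = {v, u} \<and> d u < d v" if v: "v \<in> verts G - {r}" for v
  proof -
    have "(v, r) \<in> ?A\<^sup>*"
      using T(2) v assms(2) by (auto simp: connected_graph_def)
    then have "(v, r) \<in> ?A ^^ d v"
      unfolding d_def by (metis LeastI rtrancl_power)
    moreover from this obtain k where k: "d v = Suc k"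
      using v by (cases "d v") auto
    ultimately obtain u where u: "(v, u) \<in> ?A" "(u, r) \<in> ?A ^^ k"
      by (metis relpow_Suc_D2)
    then have "d u < d v"
      unfolding k by (simp add: d_def Least_le less_Suc_eq_le)
    then show ?thesis
      using u(1) by (auto simp: adj_def)
  qed
  then obtain q where q:
    "\<And>v. v \<in> verts G - {r} \<Longrightarrow> q v \<in> T \<and> (\<exists>u. ends G (q v) = {v, u} \<and> d u < d v)"
    by metis
  define p where "p = restrict q (verts G - {r})"
  have sub: "p ` (verts G - {r}) \<subseteq> T"
    using q by (auto simp: p_def)
  have p: "p \<in> parent_edge_maps G r"
    unfolding parent_edge_maps_def
    using q T(1) by (auto simp: p_def intro!: exI[of _ d])
  \<comment> \<open>The parent edges alone connect all vertices, so any further edge of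
    \<open>T\<close> would close a cycle.\<close>
  have "e \<in> p ` (verts G - {r})" if eT: "e \<in> T" for e
  proof (rule ccontr)
    assume e: "e \<notin> p ` (verts G - {r})"
    obtain u v where uv: "u \<in> verts G" "v \<in> verts G" "ends G e = {u, v}"
      using multigraph.ends_wf[OF assms(1)] T(1) eT by blast
    have "(u, v) \<in> (adj (G\<lparr>edges := p ` (verts G - {r})\<rparr>))\<^sup>*"
      using connected_graph_parent_edges[OF assms(1) p] uv by (simp add: connected_graph_def)
    then have "(u, v) \<in> (adj (G\<lparr>edges := T - {e}\<rparr>))\<^sup>*"
      using rtrancl_mono[OF adj_mono[of "p ` (verts G - {r})" "T - {e}" G]] sub e by blast
    then have "\<exists>vs es. is_cycle (G\<lparr>edges := T\<rparr>) vs es"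
      using cycle_if_ends_connected[OF multigraph_edges_subset[OF assms(1) T(1)], of e u v] eT uv(3)
      by simp
    then show False
      using T(3) by blast
  qed
  then show ?thesis
    using that p sub by blast
qed

theorem bij_betw_parent_edge_maps_spanning_trees:
  assumes "multigraph G" "r \<in> verts G"
  shows "bij_betw (\<lambda>p. p ` (verts G - {r})) (parent_edge_maps G r) (spanning_trees G)"
  unfolding bij_betw_def
proof (intro conjI inj_on_parent_edges equalityI subsetI)
  fix T assume "T \<in> spanning_trees G"
  then show "T \<in> (\<lambda>p. p ` (verts G - {r})) ` parent_edge_maps G r"
    by (rule spanning_tree_has_parent_edges[OF assms]) blast
qed (use parent_edges_spanning_tree[OF assms(1)] in auto)

section \<open>The cone of the complete graph\<close>

text \<open>The numbers \<open>n, \<dots>, n + m - 1\<close> serve as labels for the edges to the apex.\<close>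

definition cone_parent_edges :: "nat \<Rightarrow> (nat \<Rightarrow> nat) \<Rightarrow> nat option \<Rightarrow> nat set + nat \<times> nat" where
  "cone_parent_edges n f = (\<lambda>x\<in>Some ` {..<n}.
     if f (the x) < n then Inl {the x, f (the x)} else Inr (the x, f (the x) - n))"

lemma cone_complete_graph_simps:
  "verts (cone m (complete_graph n)) - {None} = Some ` {..<n}"
  "edges (cone m (complete_graph n)) =
     Inl ` {e. e \<subseteq> {..<n} \<and> card e = 2} \<union> Inr ` ({..<n} \<times> {..<m})"
  "ends (cone m (complete_graph n)) (Inl e) = Some ` e"
  "ends (cone m (complete_graph n)) (Inr (v, i)) = {None, Some v}"
  by (auto simp: cone_def complete_graph_def)

text \<open>Edges and function values translate into each other vertex by vertex. Potentials carry
  over both ways once the apex, or all labels, get the value 0 and the vertices are raised by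
  one.\<close>

lemma bij_betw_cone_parent_edges:
  "bij_betw (cone_parent_edges n) (rooted_maps {..<n} {n..<n + m})
     (parent_edge_maps (cone m (complete_graph n)) None)"
  (is "bij_betw _ ?F ?P")
  unfolding bij_betw_def
proof
  let ?G = "cone m (complete_graph n)"
  show "inj_on (cone_parent_edges n) ?F"
  proof (rule inj_onI)
    fix f g assume fg: "f \<in> ?F" "g \<in> ?F" "cone_parent_edges n f = cone_parent_edges n g"
    have "f v = g v" if "v < n" for v
    proof -
      have "cone_parent_edges n f (Some v) = cone_parent_edges n g (Some v)"
        using fg(3) by simp
      then show ?thesis
        using that by (auto simp: cone_parent_edges_def doubleton_eq_iff split: if_splits)
    qed
    then show "f = g"
      using fg by (auto simp: rooted_maps_def intro: PiE_ext)
  qed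
  show "cone_parent_edges n ` ?F = ?P"
  proof (intro equalityI subsetI)
    fix p assume "p \<in> cone_parent_edges n ` ?F"
    then obtain f where f: "f \<in> ?F" "p = cone_parent_edges n f"
      by blast
    then obtain d :: "nat \<Rightarrow> nat" where d: "\<And>v. v < n \<Longrightarrow> d (f v) < d v"
      by (auto simp: rooted_maps_def)
    have fin: "f v < n + m" if "v < n" for v
      using f(1) that by (fastforce simp: rooted_maps_def PiE_def Pi_def)
    let ?d = "\<lambda>x. case x of None \<Rightarrow> 0 | Some v \<Rightarrow> Suc (d v)"
    have "p (Some v) \<in> edges ?G \<and> (\<exists>u. ends ?G (p (Some v)) = {Some v, u} \<and> ?d u < ?d (Some v))"
      if "v < n" for v
    proof (cases "f v < n")
      case True
      \<comment> \<open>Strict descent rules out fixed points, so \<open>{v, f v}\<close> has two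
        elements and is an edge of the complete graph.\<close>
      moreover have "f v \<noteq> v"
        using d[OF that] by auto
      ultimately show ?thesis
        using that d[OF that]
        by (auto simp: f(2) cone_parent_edges_def cone_complete_graph_simps card_2_iff
            intro!: exI[of _ "Some (f v)"])
    next
      case False
      then show ?thesis
        using that fin[OF that]
        by (auto simp: f(2) cone_parent_edges_def cone_complete_graph_simps insert_commute
            intro!: exI[of _ None])
    qed
    then show "p \<in> ?P"
      unfolding parent_edge_maps_def cone_complete_graph_simps(1)
      by (auto intro!: exI[of _ ?d] simp: f(2)) (auto simp: cone_parent_edges_def)
  next
    fix p assume p: "p \<in> ?P"
    then obtain d :: "nat option \<Rightarrow> nat" where
      d: "\<And>v. v < n \<Longrightarrow> \<exists>u. ends ?G (p (Some v)) = {Some v, u} \<and> d u < d (Some v)"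
      unfolding parent_edge_maps_def cone_complete_graph_simps(1) by auto
    have mem: "p (Some v) \<in> edges ?G" if "v < n" for v
      using p that unfolding parent_edge_maps_def cone_complete_graph_simps(1) by auto
    have ext: "p \<in> extensional (Some ` {..<n})"
      using p unfolding parent_edge_maps_def cone_complete_graph_simps(1) by (auto simp: PiE_def)
    let ?d = "\<lambda>v. if v < n then Suc (d (Some v)) else 0"
    have "\<exists>u<n + m. ?d u < ?d v \<and> p (Some v) = (if u < n then Inl {v, u} else Inr (v, u - n))"
      if v: "v < n" for v
    proof (cases "p (Some v)")
      case (Inl e)
      obtain x where x: "Some ` e = {Some v, x}" "d x < d (Some v)"
        using d[OF v] by (auto simp: Inl cone_complete_graph_simps)
      \<comment> \<open>The apex cannot occur here, since all ends of an \<open>Inl\<close> edge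
        have the form \<open>Some u\<close>.\<close>
      then obtain u where u: "x = Some u"
        by (metis imageE insertI1 insertI2 singletonI)
      then have "Some ` e = Some ` {v, u}"
        using x(1) by simp
      then have "e = {v, u}"
        by (simp only: inj_image_eq_iff[OF inj_Some])
      moreover have "u < n"
        using mem[OF v] \<open>e = {v, u}\<close> by (auto simp: Inl cone_complete_graph_simps)
      ultimately show ?thesis
        using x(2) u v Inl by (intro exI[of _ u]) auto
    next
      case (Inr a)
      obtain w i where a: "a = (w, i)"
        by (cases a)
      obtain x where "{None, Some w} = {Some v, x}"
        using d[OF v] by (auto simp: Inr a cone_complete_graph_simps)
      then have "w = v"
        by (auto simp: doubleton_eq_iff)
      moreover have "i < m"
        using mem[OF v] by (auto simp: Inr a cone_complete_graph_simps)
      ultimately show ?thesis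
        using v Inr a by (intro exI[of _ "n + i"]) auto
    qed
    then obtain g where g: "\<And>v. v < n \<Longrightarrow> g v < n + m \<and> ?d (g v) < ?d v \<and>
        p (Some v) = (if g v < n then Inl {v, g v} else Inr (v, g v - n))"
      by metis
    define f where "f = restrict g {..<n}"
    have "f \<in> ?F"
      using g unfolding rooted_maps_def by (force simp: f_def intro!: exI[of _ ?d])
    moreover have "cone_parent_edges n f = p"
      using g ext by (auto simp: cone_parent_edges_def f_def extensional_def fun_eq_iff)
    ultimately show "p \<in> cone_parent_edges n ` ?F"
      by blast
  qed
qed

lemma num_spanning_trees_cone_complete_graph:
  "(n + m) * num_spanning_trees (cone m (complete_graph n)) = m * (n + m) ^ n"
proof -
  let ?G = "cone m (complete_graph n)"
  have "None \<in> verts ?G"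
    by (simp add: cone_def)
  then have "num_spanning_trees ?G = card (parent_edge_maps ?G None)"
    unfolding num_spanning_trees_def
    using bij_betw_parent_edge_maps_spanning_trees multigraph_cone multigraph_complete_graph
    by (metis bij_betw_same_card)
  also have "\<dots> = card (rooted_maps {..<n} {n..<n + m})"
    using bij_betw_cone_parent_edges by (metis bij_betw_same_card)
  finally show ?thesis
    using card_rooted_maps[of "{..<n}" "{n..<n + m}"] by (simp add: ivl_disj_int)
qed

theorem theorem2p1:
  fixes m n :: nat
  assumes "m \<ge> 1"
  shows "real (num_spanning_trees (cone m (complete_graph n)))
           = real m * (real m + real n) powi (int n - 1)"
proof -
  have "(real m + real n) * real (num_spanning_trees (cone m (complete_graph n))) =
      real m * (real m + real n) ^ n"
    using arg_cong[OF num_spanning_trees_cone_complete_graph[of n m], of real]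
    by (simp add: add.commute)
  \<comment> \<open>Dividing by this base gives the exponent \<open>int n - 1\<close>. For
    \<open>n = 0\<close> that exponent is -1 and the formula reads
    \<open>m * inverse m = 1\<close>.\<close>
  moreover have "real m + real n \<noteq> 0"
    using assms by linarith
  ultimately show ?thesis
    by (simp add: power_int_diff field_simps)
qed

end
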